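(* Let $t>0$, $n=3^t-1$, $\nu=n/2$, let $\Lambda_n$, $\Phi$ be as in the context, and let $C\subseteq\mathbb{Z}_3^\nu$ be a ternary perfect single-error-correcting code of length $\nu$ which is linear (a subspace of $\mathbb{Z}_3^\nu$). Then $T_n=\Phi(C)+\Lambda_n$ is a lattice tiling of $\mathbb{Z}^n$ with $\Upsilon_n$, i.e. $T_n$ is a lattice in $\mathbb{R}^n$ and an integer tiling with $\Upsilon_n$.
   Context: $e_r$ is the $r$-th unit vector. $\Lambda_n\subseteq\mathbb{Z}^n$ is the lattice generated by $\{3e_{2i-1}+2e_{2i}:1\le i\le\nu\}\cup\{4e_{2i}:1\le i\le\nu\}$. $\phi:\mathbb{Z}_3\to\mathbb{Z}^2$ is given by $\phi(0)=(0,0)$, $\phi(1)=(1,2)$, $\phi(2)=(2,0)$ and $\Phi(x_1,\dots,x_\nu)=(\phi(x_1),\dots,\phi(x_\nu))\in\mathbb{Z}^n$; $\Phi(C)+\Lambda_n=\{\Phi(c)+Y:c\in C,Y\in\Lambda_n\}$. A ternary perfect single-error-correcting code of length $\nu$ is a set $C\subseteq\mathbb{Z}_3^\nu$ with pairwise Hamming distance at least $3$ such that every word is within Hamming distance $1$ of a codeword. $\Upsilon_n=\{U\in\mathbb{Z}^n:\sum_i|x_i-u_i|\le1\text{ for some }X\in\{-1,0\}^n\}$; $T\subseteq\mathbb{Z}^n$ is an integer tiling with $\Upsilon_n$ if the translates $X+\Upsilon_n$, $X\in T$, partition $\mathbb{Z}^n$. *)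

theory Defs
  imports
    "Jordan_Normal_Form.VS_Connect"
    "HOL-Library.Numeral_Type"
    "HOL-Library.Disjoint_Sets"
begin

text \<open>
  \<open>\<int>\<^sup>n\<close>, \<open>\<real>\<^sup>n\<close> and \<open>\<int>\<^sub>3\<^sup>m\<close> are \<open>carrier_vec n\<close> at type \<open>int vec\<close>, \<open>real vec\<close>
  and \<open>3 vec\<close>, where arithmetic in the numeral type \<open>3\<close> is modulo 3.
  Coordinates are counted from 0, so the pair of coordinates \<open>(2i - 1, 2i)\<close>, \<open>1 \<le> i \<le> \<nu>\<close>,
  becomes the pair \<open>(2i, 2i + 1)\<close>, \<open>i < \<nu>\<close>.
\<close>

text \<open>The numeral type \<open>3\<close> is not an instance of the class \<open>field\<close>; the following says that
  its ring structure is nevertheless a field, so that \<open>subspace\<close> below is meaningful.\<close>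

lemma field_class_ring_3: "field (class_ring :: 3 ring)"
proof -
  have ex: "x = 0 \<or> x = 1 \<or> x = 2" for x :: 3
  proof (cases x)
    case (of_int z)
    then have "z = 0 \<or> z = 1 \<or> z = 2" by auto
    with of_int show ?thesis by auto
  qed
  have inv: "\<exists>y. y * x = 1" if "x \<noteq> 0" for x :: 3
  proof -
    have "(1::3) * 1 = 1" "(2::3) * 2 = 1" by simp_all
    with ex[of x] that show ?thesis by blast
  qed
  show ?thesis
    by (rule cring.cring_fieldI2[OF class_cring.cring_axioms])
      (use inv in \<open>auto simp: mult.commute\<close>)
qed

lemma vectorspace_3: "vectorspace class_ring (module_vec TYPE(3) m)"
proof -
  interpret M: vec_module "TYPE(3)" m .
  show ?thesis
    by (rule vectorspace.intro[OF M.module_axioms field_class_ring_3])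
qed

definition hamming_dist :: "'a vec \<Rightarrow> 'a vec \<Rightarrow> nat" where
  "hamming_dist x y = card {i. i < dim_vec x \<and> x $ i \<noteq> y $ i}"

definition ternary_perfect_code :: "nat \<Rightarrow> 3 vec set \<Rightarrow> bool" where
  "ternary_perfect_code m C \<longleftrightarrow>
     C \<subseteq> carrier_vec m \<and>
     (\<forall>x\<in>C. \<forall>y\<in>C. x \<noteq> y \<longrightarrow> hamming_dist x y \<ge> 3) \<and>
     (\<forall>w\<in>carrier_vec m. \<exists>c\<in>C. hamming_dist w c \<le> 1)"

abbreviation linear_code :: "nat \<Rightarrow> 3 vec set \<Rightarrow> bool" where
  "linear_code m C \<equiv> subspace class_ring C (module_vec TYPE(3) m)"

definition Upsilon :: "nat \<Rightarrow> int vec set" where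
  "Upsilon n = {U \<in> carrier_vec n. \<exists>X\<in>carrier_vec n.
     (\<forall>i<n. X $ i \<in> {-1, 0}) \<and> (\<Sum>i<n. \<bar>X $ i - U $ i\<bar>) \<le> 1}"

definition integer_tiling :: "nat \<Rightarrow> int vec set \<Rightarrow> int vec set \<Rightarrow> bool" where
  "integer_tiling n S T \<longleftrightarrow>
     T \<subseteq> carrier_vec n \<and>
     (\<Union>X\<in>T. (\<lambda>U. X + U) ` S) = carrier_vec n \<and>
     disjoint_family_on (\<lambda>X. (\<lambda>U. X + U) ` S) T"

text \<open>A lattice in \<open>\<real>\<^sup>n\<close> is the set of integer combinations of some basis of \<open>\<real>\<^sup>n\<close>.\<close>

definition is_lattice :: "nat \<Rightarrow> real vec set \<Rightarrow> bool" where
  "is_lattice n L \<longleftrightarrow>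
     (\<exists>B. vectorspace.basis class_ring (module_vec TYPE(real) n) B \<and>
        L = {LinearCombinations.module.lincomb (module_vec TYPE(real) n) (\<lambda>v. real_of_int (a v)) B
             | a :: real vec \<Rightarrow> int. True})"

definition lattice_tiling :: "nat \<Rightarrow> int vec set \<Rightarrow> int vec set \<Rightarrow> bool" where
  "lattice_tiling n S T \<longleftrightarrow> is_lattice n (map_vec real_of_int ` T) \<and> integer_tiling n S T"

definition Lambda :: "nat \<Rightarrow> int vec set" where
  "Lambda n = LinearCombinations.module.span class_ring (module_vec TYPE(int) n)
     ({3 \<cdot>\<^sub>v unit_vec n (2 * i) + 2 \<cdot>\<^sub>v unit_vec n (2 * i + 1) | i. i < n div 2} \<union>
      {4 \<cdot>\<^sub>v unit_vec n (2 * i + 1) | i. i < n div 2})"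

definition phi :: "3 \<Rightarrow> int \<times> int" where
  "phi x = (if x = 0 then (0, 0) else if x = 1 then (1, 2) else (2, 0))"

definition Phi :: "3 vec \<Rightarrow> int vec" where
  "Phi x = vec (2 * dim_vec x)
     (\<lambda>j. if even j then fst (phi (x $ (j div 2))) else snd (phi (x $ (j div 2))))"

definition Tset :: "nat \<Rightarrow> 3 vec set \<Rightarrow> int vec set" where
  "Tset n C = {Phi c + Y | c Y. c \<in> C \<and> Y \<in> Lambda n}"

end

theory Submission
  imports Defs
begin

text \<open>
  The pairs \<open>(a, b)\<close> with \<open>b \<equiv> 2a (mod 4)\<close> are exactly \<open>\<phi>(\<int>\<^sub>3) + \<Lambda>\<^sub>2\<close>, and \<open>a mod 3\<close> recovers the
  element of \<open>\<int>\<^sub>3\<close>. So \<open>T\<^sub>n\<close> is the set of \<open>x\<close> all of whose coordinate pairs \<open>(a, b)\<close> satisfy this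
  congruence and whose residues \<open>a mod 3\<close> form a codeword. The square \<open>{-1, 0}\<^sup>2\<close> represents each
  class of \<open>b - 2a (mod 4)\<close> once, and the square together with its eight neighbours represents
  each pair \<open>(b - 2a mod 4, a mod 3)\<close> once. A point of \<open>\<Upsilon>\<^sub>n\<close> has all its pairs in the square
  except at most one, which may be a neighbour. Subtracting from a given \<open>w\<close> the points of \<open>\<Upsilon>\<^sub>n\<close>
  of the right class modulo 4 therefore produces each word of one Hamming ball of radius 1
  exactly once, and perfectness of the code gives the tiling. Linearity makes \<open>T\<^sub>n\<close> a subgroup
  of \<open>\<int>\<^sup>n\<close>, and it contains \<open>12\<int>\<^sup>n\<close>.
\<close>

section \<open>Finite-index subgroups of \<open>\<int>\<^sup>n\<close>\<close>

text \<open>Isolates what the lattice property needs of the tiling set. Finiteness of the index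
  enters later, through multiples of the unit vectors.\<close>

locale int_vec_subgroup =
  fixes n :: nat and T :: "int vec set"
  assumes subset_carrier: "T \<subseteq> carrier_vec n"
    and zero_mem: "0\<^sub>v n \<in> T"
    and diff_mem: "x \<in> T \<Longrightarrow> y \<in> T \<Longrightarrow> x - y \<in> T"
begin

lemma carrier_mem: "x \<in> T \<Longrightarrow> x \<in> carrier_vec n"
  using subset_carrier by blast

lemma add_mem:
  assumes "x \<in> T" "y \<in> T"
  shows "x + y \<in> T"
proof -
  have "x + y = x - (0\<^sub>v n - y)"
    using assms carrier_mem by (intro eq_vecI) auto
  then show ?thesis
    using diff_mem zero_mem assms by simp
qed

lemma smult_mem:
  assumes x: "x \<in> T"
  shows "q \<cdot>\<^sub>v x \<in> T"
proof (induction q rule: int_induct[where k = 0])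
  case base
  have "0 \<cdot>\<^sub>v x = 0\<^sub>v n" using carrier_mem[OF x] by (intro eq_vecI) auto
  then show ?case using zero_mem by simp
next
  case (step1 q)
  moreover have "(q + 1) \<cdot>\<^sub>v x = q \<cdot>\<^sub>v x + x"
    using carrier_mem[OF x] by (intro eq_vecI) (auto simp: algebra_simps)
  ultimately show ?case using add_mem x by simp
next
  case (step2 q)
  moreover have "(q - 1) \<cdot>\<^sub>v x = q \<cdot>\<^sub>v x - x"
    using carrier_mem[OF x] by (intro eq_vecI) (auto simp: algebra_simps)
  ultimately show ?case using diff_mem x by simp
qed

text \<open>Spelled out by coordinates because real combinations of the basis are compared
  coordinatewise with images of integer vectors in \<open>is_lattice\<close>.\<close>

lemma sum_mem:
  fixes k :: nat
  assumes "\<And>i. i < k \<Longrightarrow> b i \<in> T"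
  shows "vec n (\<lambda>j. \<Sum>i<k. c i * b i $ j) \<in> T"
  using assms
proof (induction k)
  case 0
  have "vec n (\<lambda>j. \<Sum>i<0. c i * b i $ j) = 0\<^sub>v n" by (intro eq_vecI) auto
  then show ?case using zero_mem by simp
next
  case (Suc k)
  have "vec n (\<lambda>j. \<Sum>i<Suc k. c i * b i $ j) = vec n (\<lambda>j. \<Sum>i<k. c i * b i $ j) + c k \<cdot>\<^sub>v b k"
    using carrier_mem[OF Suc.prems[of k]] by (intro eq_vecI) auto
  then show ?case
    using Suc add_mem smult_mem by simp
qed

text \<open>Euclidean division in one coordinate. The given multiple of the unit vector shows that
  candidates for \<open>b\<close> exist, and one with least \<open>i\<close>-th coordinate is taken.
  The remainder of \<open>x $ i\<close> modulo \<open>b $ i\<close> is the \<open>i\<close>-th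
  coordinate of another member vanishing before \<open>i\<close>, so minimality forces it to be
  0.\<close>

lemma ex_pivot:
  assumes m: "m > 0" and i: "i < n" and "m \<cdot>\<^sub>v unit_vec n i \<in> T"
  obtains b where "b \<in> T" "\<And>j. j < i \<Longrightarrow> b $ j = 0" "b $ i > 0"
    "\<And>x. x \<in> T \<Longrightarrow> (\<forall>j<i. x $ j = 0) \<Longrightarrow> b $ i dvd x $ i"
proof -
  define P where "P b \<longleftrightarrow> b \<in> T \<and> (\<forall>j<i. b $ j = 0) \<and> b $ i > 0" for b
  have "P (m \<cdot>\<^sub>v unit_vec n i)"
    using assms by (auto simp: P_def)
  from ex_has_least_nat[of P, OF this, of "\<lambda>b. nat (b $ i)"]
  obtain b where b: "P b" and least: "\<And>y. P y \<Longrightarrow> nat (b $ i) \<le> nat (y $ i)"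
    by blast
  show thesis
  proof
    fix x assume x: "x \<in> T" "\<forall>j<i. x $ j = 0"
    define y where "y = x - (x $ i div b $ i) \<cdot>\<^sub>v b"
    have bc: "b \<in> carrier_vec n" and xc: "x \<in> carrier_vec n"
      using b x carrier_mem by (auto simp: P_def)
    have "y \<in> T" using b x diff_mem smult_mem by (auto simp: y_def P_def)
    moreover have "y $ j = 0" if "j < i" for j
      using that i b x bc xc by (auto simp: y_def P_def)
    moreover have yi: "y $ i = x $ i mod b $ i"
      using i bc xc by (simp add: y_def minus_div_mult_eq_mod)
    moreover have "0 \<le> x $ i mod b $ i" "x $ i mod b $ i < b $ i"
      using b by (auto simp: P_def)
    ultimately have "x $ i mod b $ i = 0"
      using least[of y] by (force simp: P_def)
    then show "b $ i dvd x $ i" by auto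
  qed (use b in \<open>auto simp: P_def\<close>)
qed

text \<open>The lattice basis is a Hermite normal form: its \<open>i\<close>-th vector vanishes in the first
  \<open>i\<close> coordinates and has the smallest possible positive \<open>i\<close>-th coordinate.\<close>

lemma is_lattice:
  assumes m: "m > 0" "\<And>i. i < n \<Longrightarrow> m \<cdot>\<^sub>v unit_vec n i \<in> T"
  shows "is_lattice n (map_vec real_of_int ` T)"
proof -
  have "\<exists>b. b \<in> T \<and> (\<forall>j<i. b $ j = 0) \<and> b $ i > 0 \<and>
      (\<forall>x\<in>T. (\<forall>j<i. x $ j = 0) \<longrightarrow> b $ i dvd x $ i)" if "i < n" for i
    using ex_pivot[OF m(1) that m(2)[OF that]] by metis
  then obtain b where bT: "\<And>i. i < n \<Longrightarrow> b i \<in> T"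
    and b0: "\<And>i j. i < n \<Longrightarrow> j < i \<Longrightarrow> b i $ j = 0"
    and bpos: "\<And>i. i < n \<Longrightarrow> b i $ i > 0"
    and bdvd: "\<And>i x. i < n \<Longrightarrow> x \<in> T \<Longrightarrow> (\<forall>j<i. x $ j = 0) \<Longrightarrow> b i $ i dvd x $ i"
    by metis
  have bc: "b i \<in> carrier_vec n" if "i < n" for i
    using bT[OF that] carrier_mem by blast
  \<comment> \<open>Forward elimination: \<open>k\<close> counts leading zeros, and the induction
    runs down from \<open>k = n\<close>, where \<open>x\<close> is zero. A multiple of the pivot
    vector \<open>b k\<close> clears coordinate \<open>k\<close> without disturbing the earlier
    ones.\<close>
  have gen: "\<exists>c. \<forall>j<n. x $ j = (\<Sum>i<n. c i * b i $ j)"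
    if "k \<le> n" "x \<in> T" "\<forall>j<k. x $ j = 0" for k x
    using that
  proof (induction k arbitrary: x rule: inc_induct)
    case base
    then show ?case by (intro exI[of _ "\<lambda>_. 0"]) auto
  next
    case (step k)
    have xc: "x \<in> carrier_vec n" using step.prems carrier_mem by blast
    from bdvd[OF step.hyps(2) step.prems] obtain q where q: "x $ k = b k $ k * q" by (elim dvdE)
    let ?y = "x - q \<cdot>\<^sub>v b k"
    have "?y \<in> T" using step bT diff_mem smult_mem by auto
    moreover have "\<forall>j<Suc k. ?y $ j = 0"
      using step.prems step.hyps q b0 bc[OF step.hyps(2)] xc by (auto simp: less_Suc_eq)
    ultimately obtain c where c: "\<And>j. j < n \<Longrightarrow> ?y $ j = (\<Sum>i<n. c i * b i $ j)"
      using step.IH by blast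
    have "x $ j = (\<Sum>i<n. (c i + (if i = k then q else 0)) * b i $ j)" if j: "j < n" for j
    proof -
      have "(\<Sum>i<n. (c i + (if i = k then q else 0)) * b i $ j) =
          (\<Sum>i<n. c i * b i $ j) + (\<Sum>i<n. if i = k then q * b i $ j else 0)"
        by (subst sum.distrib[symmetric], rule sum.cong) (auto simp: algebra_simps)
      also have "\<dots> = ?y $ j + q * b k $ j"
        using c[OF j] step.hyps by simp
      also have "\<dots> = x $ j"
        using j xc bc[OF step.hyps(2)] by simp
      finally show ?thesis by simp
    qed
    then show ?case
      by (intro exI[of _ "\<lambda>i. c i + (if i = k then q else 0)"]) simp
  qed

  \<comment> \<open>The rows of \<open>A\<close> are the pivot vectors. An upper triangular matrix
    with positive diagonal has rows that form a basis over the reals.\<close>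
  define A where "A = mat n n (\<lambda>(i, j). real_of_int (b i $ j))"
  define f where "f i = map_vec real_of_int (b i)" for i
  interpret R: vec_space "TYPE(real)" n .
  have A: "A \<in> carrier_mat n n" by (simp add: A_def)
  have tri: "upper_triangular A" by (auto simp: A_def b0 intro!: upper_triangularI)
  have diag: "0 \<notin> set (diag_mat A)"
    using bpos by (fastforce simp: diag_mat_def A_def)
  have row: "rows A ! i = f i" if "i < n" for i
    using that bc[OF that] by (intro eq_vecI) (auto simp: A_def f_def)
  have setB: "set (rows A) = f ` {..<n}"
    using row A by (force simp: set_conv_nth)
  \<comment> \<open>Distinctness of the rows lets sums over the set of basis vectors be reindexed by
    \<open>i\<close>.\<close>
  have inj: "inj_on f {..<n}"
    using upper_triangular_imp_distinct[OF A tri diag] row A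
    by (intro inj_onI) (metis carrier_matD(1) length_rows lessThan_iff nth_eq_iff_index_eq)
  have BC: "f ` {..<n} \<subseteq> carrier_vec n"
    using bc by (auto simp: f_def)
  have lin: "R.lincomb a (f ` {..<n}) $ j = (\<Sum>i<n. a (f i) * real_of_int (b i $ j))"
    if "j < n" for a j
    unfolding R.lincomb_index[OF that BC] sum.reindex[OF inj]
    by (rule sum.cong) (use that bc[THEN carrier_vecD] in \<open>auto simp: f_def\<close>)
  have lin_dim: "dim_vec (R.lincomb a (f ` {..<n})) = n" for a
    by (rule R.lincomb_dim[OF _ BC]) simp
  show ?thesis
    unfolding is_lattice_def
  proof (intro exI[of _ "f ` {..<n}"] conjI)
    show "R.basis (f ` {..<n})"
      using R.upper_triangular_imp_basis[OF A tri diag] by (simp add: setB)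
    show "map_vec real_of_int ` T =
        {R.lincomb (\<lambda>v. real_of_int (a v)) (f ` {..<n}) | a :: real vec \<Rightarrow> int. True}"
    proof (intro equalityI subsetI)
      fix x assume "x \<in> map_vec real_of_int ` T"
      then obtain y where y: "y \<in> T" "x = map_vec real_of_int y" by blast
      from gen[of 0 y] y obtain c where c: "\<And>j. j < n \<Longrightarrow> y $ j = (\<Sum>i<n. c i * b i $ j)"
        by auto
      \<comment> \<open>Coefficients are functions of basis vectors here, so \<open>c\<close> is
        carried over from indices along the inverse of \<open>f\<close>.\<close>
      have "x = R.lincomb (\<lambda>v. real_of_int (c (the_inv_into {..<n} f v))) (f ` {..<n})"
        using y carrier_mem[OF y(1)] c
        by (intro eq_vecI) (auto simp: lin lin_dim the_inv_into_f_f[OF inj])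
      then show "x \<in> {R.lincomb (\<lambda>v. real_of_int (a v)) (f ` {..<n}) | a :: real vec \<Rightarrow> int. True}"
        by (intro CollectI exI[of _ "\<lambda>v. c (the_inv_into {..<n} f v)"]) simp
    next
      fix x assume "x \<in> {R.lincomb (\<lambda>v. real_of_int (a v)) (f ` {..<n}) | a :: real vec \<Rightarrow> int. True}"
      then obtain a :: "real vec \<Rightarrow> int"
        where x: "x = R.lincomb (\<lambda>v. real_of_int (a v)) (f ` {..<n})" by blast
      have "x = map_vec real_of_int (vec n (\<lambda>j. \<Sum>i<n. a (f i) * b i $ j))"
        unfolding x by (intro eq_vecI) (auto simp: lin lin_dim)
      then show "x \<in> map_vec real_of_int ` T"
        using sum_mem[of n b "\<lambda>i. a (f i)"] bT by blast
    qed
  qed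
qed

end

section \<open>Congruence description of \<open>T\<^sub>n\<close>\<close>

lemma three_cases:
  obtains "x = (0 :: 3)" | "x = 1" | "x = 2"
proof (cases x)
  case (of_int z)
  then have "z = 0 \<or> z = 1 \<or> z = 2" by auto
  with of_int that show ?thesis by auto
qed

lemma three_eq_0: "(3 :: 3) = 0"
  by simp

lemma of_int_3_eq_0_iff: "(of_int z :: 3) = 0 \<longleftrightarrow> 3 dvd z"
proof -
  have "(of_int z :: 3) = of_int (3 * (z div 3) + z mod 3)" by simp
  also have "\<dots> = of_int (z mod 3)" by (simp only: of_int_add of_int_mult of_int_numeral three_eq_0 mult_zero_left add_0)
  finally have *: "(of_int z :: 3) = of_int (z mod 3)" .
  have "z mod 3 = 0 \<or> z mod 3 = 1 \<or> z mod 3 = 2" by presburger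
  then show ?thesis using * by (auto simp: dvd_eq_mod_eq_0)
qed

lemma of_int_3_eq_iff: "(of_int a :: 3) = of_int b \<longleftrightarrow> 3 dvd a - b"
  by (metis eq_iff_diff_eq_0 of_int_3_eq_0_iff of_int_diff)

lemma all_less_double:
  "(\<forall>j < 2 * m. P j) \<longleftrightarrow> (\<forall>i < m. P (2 * i) \<and> P (2 * i + 1))" for m :: nat
proof (intro iffI allI impI)
  fix j assume *: "\<forall>i < m. P (2 * i) \<and> P (2 * i + 1)" "j < 2 * m"
  then have "j div 2 < m" by auto
  then have "P (2 * (j div 2))" "P (2 * (j div 2) + 1)" using * by auto
  moreover have "j = 2 * (j div 2) \<or> j = 2 * (j div 2) + 1" by presburger
  ultimately show "P j" by metis
qed auto

text \<open>The congruences define a submodule containing the generators (3, 2) and (0, 4) of each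
  pair. Conversely, a pair (3a, 6a + 4d) equals a(3, 2) + (a + d)(0, 4), so the pairs of
  \<open>x\<close> can be split off one at a time.\<close>

lemma Lambda_iff:
  assumes n: "n = 2 * m"
  shows "x \<in> Lambda n \<longleftrightarrow> x \<in> carrier_vec n \<and>
    (\<forall>i<m. 3 dvd x $ (2 * i) \<and> 4 dvd x $ (2 * i + 1) - 2 * x $ (2 * i))"
    (is "_ \<longleftrightarrow> ?R x")
proof -
  interpret M: vec_module "TYPE(int)" n .
  define g :: "nat \<Rightarrow> int vec" where "g i = 3 \<cdot>\<^sub>v unit_vec n (2 * i) + 2 \<cdot>\<^sub>v unit_vec n (2 * i + 1)" for i
  define h :: "nat \<Rightarrow> int vec" where "h i = 4 \<cdot>\<^sub>v unit_vec n (2 * i + 1)" for i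
  define G :: "int vec set" where "G = g ` {..<m} \<union> h ` {..<m}"
  have L: "Lambda n = M.span G"
  proof -
    have "{3 \<cdot>\<^sub>v unit_vec n (2 * i) + 2 \<cdot>\<^sub>v unit_vec n (2 * i + 1) | i. i < n div 2} \<union>
      {4 \<cdot>\<^sub>v unit_vec n (2 * i + 1) | i. i < n div 2} = G"
      using n by (auto simp: G_def g_def h_def)
    then show ?thesis by (simp add: Lambda_def)
  qed
  have gh: "g i \<in> carrier_vec n" "h i \<in> carrier_vec n" for i
    by (auto simp: g_def h_def)
  have GC: "G \<subseteq> carrier_vec n"
    using gh by (auto simp: G_def)
  interpret S: submodule class_ring "M.span G" M.V
    by (rule M.span_is_submodule[OF GC])
  have S_add: "u + v \<in> M.span G" if "u \<in> M.span G" "v \<in> M.span G" for u v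
    using S.m_closed[OF that] by (simp add: module_vec_simps)
  have S_smult: "q \<cdot>\<^sub>v v \<in> M.span G" if "v \<in> M.span G" for q v
    using S.smult_closed[OF _ that, of q] by (simp add: module_vec_simps class_ring_simps)
  have idx: "j < n \<Longrightarrow> g i $ j = (if j = 2 * i then 3 else if j = 2 * i + 1 then 2 else 0)"
    "j < n \<Longrightarrow> h i $ j = (if j = 2 * i + 1 then 4 else 0)" for i j
    by (auto simp: g_def h_def unit_vec_def)
  have sub: "submodule class_ring {x. ?R x} M.V"
  proof (unfold_locales, goal_cases)
    case (2 v w)
    then show ?case using n
      by (auto simp: module_vec_simps algebra_simps dest!: spec)
        (smt (verit) dvd_add add_diff_add distrib_left)
  next
    case (4 c v)
    then show ?case using n
      by (auto simp: module_vec_simps)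
        (metis (no_types, opaque_lifting) dvd_mult mult.left_commute right_diff_distrib)
  qed (use n in \<open>auto simp: module_vec_simps\<close>)
  have "G \<subseteq> {x. ?R x}"
    using n gh by (auto simp: G_def idx double_not_eq_Suc_double Suc_double_not_eq_double)
  then have "M.span G \<subseteq> {x. ?R x}"
    using M.span_is_subset[OF _ sub] by blast
  moreover have "x \<in> M.span G" if "?R x" for x
  proof -
    \<comment> \<open>Only the first \<open>k\<close> pairs may be nonzero; each induction step
      removes the last of them.\<close>
    have "k \<le> m \<Longrightarrow> ?R x \<Longrightarrow> (\<forall>j<n. 2 * k \<le> j \<longrightarrow> x $ j = 0) \<Longrightarrow> x \<in> M.span G" for k
    proof (induction k arbitrary: x)
      case 0
      then have "x = 0\<^sub>v n" by (intro eq_vecI) auto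
      then show ?case using S.zero_closed by (simp add: module_vec_simps)
    next
      case (Suc k)
      then have k: "k < m" and k2: "2 * k < n" "2 * k + 1 < n" using n by auto
      from Suc.prems k obtain a where a: "x $ (2 * k) = 3 * a" by (auto elim!: dvdE)
      from Suc.prems k obtain d where d: "x $ (2 * k + 1) - 2 * x $ (2 * k) = 4 * d"
        by (auto elim!: dvdE)
      define z where "z = a \<cdot>\<^sub>v g k + (a + d) \<cdot>\<^sub>v h k"
      have zC: "z \<in> carrier_vec n" using gh by (auto simp: z_def)
      have zj: "z $ j = a * g k $ j + (a + d) * h k $ j" if "j < n" for j
        using that gh[THEN carrier_vecD] by (simp add: z_def)
      have "z $ (2 * k) = x $ (2 * k)" "z $ (2 * k + 1) = x $ (2 * k + 1)"
        using k2 a d by (auto simp: zj idx)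
      moreover have z0: "z $ j = 0" if "j < n" "j \<noteq> 2 * k" "j \<noteq> 2 * k + 1" for j
        using that by (auto simp: zj idx)
      ultimately have zx: "z $ j = (if j = 2 * k \<or> j = 2 * k + 1 then x $ j else 0)"
        if "j < n" for j using that by auto
      have "x - z \<in> M.span G"
      proof (rule Suc.IH)
        show "?R (x - z)"
          using Suc.prems(2) zC n by (auto simp: zx)
        show "\<forall>j<n. 2 * k \<le> j \<longrightarrow> (x - z) $ j = 0"
          using Suc.prems zC by (auto simp: zx)
      qed (use Suc.prems in simp)
      moreover have "g k \<in> M.span G" "h k \<in> M.span G"
        using k M.in_own_span[OF GC] by (auto simp: G_def)
      then have "z \<in> M.span G"
        unfolding z_def by (intro S_add S_smult)
      ultimately have "(x - z) + z \<in> M.span G"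
        by (rule S_add)
      moreover have "(x - z) + z = x"
        using zC Suc.prems(2) by (intro eq_vecI) auto
      ultimately show ?case by simp
    qed
    from this[of m] that n show ?thesis by auto
  qed
  ultimately show ?thesis unfolding L by blast
qed

text \<open>The first entry of a pair suffices: \<open>phi\<close> puts a representative of its
  argument there, and elements of \<open>Lambda n\<close> change it by multiples of 3.\<close>

definition residues3 :: "nat \<Rightarrow> int vec \<Rightarrow> 3 vec" where
  "residues3 m x = vec m (\<lambda>i. of_int (x $ (2 * i)))"

lemma residues3_simps [simp]:
  "residues3 m x \<in> carrier_vec m"
  "dim_vec (residues3 m x) = m"
  "i < m \<Longrightarrow> residues3 m x $ i = of_int (x $ (2 * i))"
  by (auto simp: residues3_def)

lemma of_int_fst_phi: "of_int (fst (phi x)) = x"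
  by (rule three_cases[of x]) (auto simp: phi_def)

lemma snd_phi: "4 dvd snd (phi x) - 2 * fst (phi x)"
  by (auto simp: phi_def)

lemma Phi_index:
  assumes "i < dim_vec x"
  shows "Phi x $ (2 * i) = fst (phi (x $ i))" "Phi x $ (2 * i + 1) = snd (phi (x $ i))"
  using assms by (auto simp: Phi_def)

text \<open>\<open>Phi c\<close> satisfies the congruences modulo 4 and has residue word
  \<open>c\<close>; adding an element of \<open>Lambda n\<close> preserves both. Conversely,
  subtracting \<open>Phi\<close> of the residue word leaves a vector that meets the criterion of
  \<open>Lambda_iff\<close>.\<close>

lemma Tset_iff:
  assumes n: "n = 2 * m" and C: "C \<subseteq> carrier_vec m"
  shows "x \<in> Tset n C \<longleftrightarrow> x \<in> carrier_vec n \<and>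
    (\<forall>i<m. 4 dvd x $ (2 * i + 1) - 2 * x $ (2 * i)) \<and> residues3 m x \<in> C"
proof (intro iffI conjI)
  assume "x \<in> Tset n C"
  then obtain c Y where x: "x = Phi c + Y" and c: "c \<in> C" and "Y \<in> Lambda n"
    by (auto simp: Tset_def)
  then have YC: "Y \<in> carrier_vec n"
    and Y: "\<And>i. i < m \<Longrightarrow> 3 dvd Y $ (2 * i) \<and> 4 dvd Y $ (2 * i + 1) - 2 * Y $ (2 * i)"
    using Lambda_iff[OF n] by auto
  have dc: "dim_vec c = m" using c C by auto
  show "x \<in> carrier_vec n" using x YC by (auto intro: carrier_vecI)
  have xi: "x $ (2 * i) = fst (phi (c $ i)) + Y $ (2 * i)"
    "x $ (2 * i + 1) = snd (phi (c $ i)) + Y $ (2 * i + 1)" if "i < m" for i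
    using that YC n dc Phi_index[of i c] by (auto simp: x)
  show "\<forall>i<m. 4 dvd x $ (2 * i + 1) - 2 * x $ (2 * i)"
  proof (intro allI impI)
    fix i assume i: "i < m"
    show "4 dvd x $ (2 * i + 1) - 2 * x $ (2 * i)"
      using dvd_add[OF snd_phi[of "c $ i"] Y[OF i, THEN conjunct2]] unfolding xi[OF i]
      by (simp add: algebra_simps)
  qed
  have "residues3 m x = c"
  proof (intro eq_vecI)
    fix i assume "i < dim_vec c"
    then have i: "i < m" using dc by simp
    show "residues3 m x $ i = c $ i"
      using Y[OF i] i of_int_3_eq_0_iff[of "Y $ (2 * i)"]
      by (simp add: xi(1)[OF i] of_int_fst_phi)
  qed (simp add: dc)
  then show "residues3 m x \<in> C" using c by simp
next
  assume x: "x \<in> carrier_vec n \<and>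
    (\<forall>i<m. 4 dvd x $ (2 * i + 1) - 2 * x $ (2 * i)) \<and> residues3 m x \<in> C"
  let ?c = "residues3 m x"
  let ?Y = "x - Phi ?c"
  have PC: "Phi ?c \<in> carrier_vec n" by (auto simp: Phi_def n)
  have "?Y \<in> Lambda n"
    unfolding Lambda_iff[OF n]
  proof (intro conjI allI impI)
    fix i assume i: "i < m"
    have idx: "?Y $ (2 * i) = x $ (2 * i) - fst (phi (of_int (x $ (2 * i))))"
      "?Y $ (2 * i + 1) = x $ (2 * i + 1) - snd (phi (of_int (x $ (2 * i))))"
      using i n x PC Phi_index[of i ?c] by auto
    show "3 dvd ?Y $ (2 * i)"
      unfolding idx of_int_3_eq_iff[symmetric] of_int_fst_phi ..
    have "4 dvd x $ (2 * i + 1) - 2 * x $ (2 * i)" using x i by auto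
    from dvd_diff[OF this snd_phi[of "of_int (x $ (2 * i))"]]
    show "4 dvd ?Y $ (2 * i + 1) - 2 * ?Y $ (2 * i)"
      unfolding idx by (simp add: algebra_simps)
  qed (use x PC in auto)
  moreover have "x = Phi ?c + ?Y"
    using x PC by (intro eq_vecI) auto
  ultimately show "x \<in> Tset n C"
    using x unfolding Tset_def by blast
qed

section \<open>Tiling\<close>

text \<open>A total distance of at most 1 from the cube means that at most one coordinate leaves
  \<open>{-1, 0}\<close>, and that one by a single unit.\<close>

lemma Upsilon_iff:
  "U \<in> Upsilon n \<longleftrightarrow> U \<in> carrier_vec n \<and> (\<forall>i<n. U $ i \<in> {-2..1}) \<and>
    (\<forall>i<n. \<forall>j<n. U $ i \<notin> {-1, 0} \<and> U $ j \<notin> {-1, 0} \<longrightarrow> i = j)"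
    (is "_ \<longleftrightarrow> ?R")
proof
  assume "U \<in> Upsilon n"
  then obtain X where UC: "U \<in> carrier_vec n" and X: "\<forall>i<n. X $ i \<in> {-1, 0}"
    and le: "(\<Sum>i<n. \<bar>X $ i - U $ i\<bar>) \<le> 1"
    by (auto simp: Upsilon_def)
  have 1: "U $ i \<in> {-2..1}" if "i < n" for i
    using member_le_sum[of i "{..<n}" "\<lambda>i. \<bar>X $ i - U $ i\<bar>"] le X that by force
  have 2: "i = j" if ij: "i < n" "j < n" "U $ i \<notin> {-1, 0}" "U $ j \<notin> {-1, 0}" for i j
  proof (rule ccontr)
    assume "i \<noteq> j"
    then have "\<bar>X $ i - U $ i\<bar> + \<bar>X $ j - U $ j\<bar> = (\<Sum>i\<in>{i, j}. \<bar>X $ i - U $ i\<bar>)" by simp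
    also have "\<dots> \<le> (\<Sum>i<n. \<bar>X $ i - U $ i\<bar>)"
      by (rule sum_mono2) (use ij in auto)
    finally show False
      using le X ij by (smt (verit) insert_iff)
  qed
  from UC 1 2 show ?R by blast
next
  assume R: ?R
  \<comment> \<open>Clamping each coordinate to \<open>{-1, 0}\<close> gives a nearest point of the
    cube.\<close>
  define X where "X = vec n (\<lambda>i. max (-1) (min 0 (U $ i)))"
  have X: "X $ i \<in> {-1, 0}" if "i < n" for i
    using that by (auto simp: X_def)
  have diff: "\<bar>X $ i - U $ i\<bar> = (if U $ i \<in> {-1, 0} then 0 else 1)" if "i < n" for i
  proof -
    have "U $ i \<in> {-2..1}" using R that by blast
    then show ?thesis using that by (auto simp: X_def)
  qed
  have "(\<Sum>i<n. \<bar>X $ i - U $ i\<bar>) = (\<Sum>i<n. if U $ i \<in> {-1, 0} then 0 else 1)"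
    by (rule sum.cong) (simp_all only: diff lessThan_iff)
  also have "\<dots> \<le> 1"
  proof (cases "\<exists>k<n. U $ k \<notin> {-1, 0}")
    case True
    then obtain k where k: "k < n" "U $ k \<notin> {-1, 0}" by blast
    have "(\<Sum>i<n. if U $ i \<in> {-1, 0} then 0 else 1) = (\<Sum>i<n. if i = k then 1 else (0 :: int))"
      by (rule sum.cong) (use k R in \<open>auto 0 0\<close>)
    then show ?thesis using k by simp
  next
    case False
    then have "(\<Sum>i<n. if U $ i \<in> {-1, 0} then 0 else 1) = (0 :: int)"
      by (intro sum.neutral) auto
    then show ?thesis by simp
  qed
  finally have "(\<Sum>i<n. \<bar>X $ i - U $ i\<bar>) \<le> 1" .
  moreover have "X \<in> carrier_vec n" by (simp add: X_def)
  ultimately show "U \<in> Upsilon n"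
    using X R unfolding Upsilon_def by blast
qed

section \<open>The planar square, its neighbours and their residue classes\<close>

definition square :: "int \<Rightarrow> int \<Rightarrow> bool" where
  "square a b \<longleftrightarrow> a \<in> {-1, 0} \<and> b \<in> {-1, 0}"

text \<open>This is the planar case of \<open>Upsilon\<close>: the four points of the square and
  their eight edge neighbours, as many as there are pairs of a class modulo 4 and a class modulo
  3.\<close>

definition cross :: "int \<Rightarrow> int \<Rightarrow> bool" where
  "cross a b \<longleftrightarrow> a \<in> {-1, 0} \<and> b \<in> {-2..1} \<or> a \<in> {-2..1} \<and> b \<in> {-1, 0}"

text \<open>Two distinct coordinates outside \<open>{-1, 0}\<close> either share a pair, which
  \<open>cross\<close> forbids, or put two different pairs outside the square.\<close>

lemma Upsilon_pairs_iff:
  assumes n: "n = 2 * m"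
  shows "U \<in> Upsilon n \<longleftrightarrow> U \<in> carrier_vec n \<and>
    (\<forall>i<m. cross (U $ (2 * i)) (U $ (2 * i + 1))) \<and>
    (\<forall>i<m. \<forall>j<m. \<not> square (U $ (2 * i)) (U $ (2 * i + 1)) \<and>
       \<not> square (U $ (2 * j)) (U $ (2 * j + 1)) \<longrightarrow> i = j)"
    (is "_ \<longleftrightarrow> ?C \<and> ?X \<and> ?S")
proof -
  have "(\<forall>i<n. U $ i \<in> {-2..1}) \<and>
      (\<forall>i<n. \<forall>j<n. U $ i \<notin> {-1, 0} \<and> U $ j \<notin> {-1, 0} \<longrightarrow> i = j) \<longleftrightarrow> ?X \<and> ?S"
    (is "?A \<and> ?B \<longleftrightarrow> _")
  proof
    assume AB: "?A \<and> ?B"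
    have par: "2 * i \<noteq> 2 * j + 1" for i j :: nat by presburger
    have ?X
    proof (intro allI impI)
      fix i assume "i < m"
      then have *: "2 * i < n" "2 * i + 1 < n" using n by auto
      with AB have "U $ (2 * i) \<in> {-1, 0} \<or> U $ (2 * i + 1) \<in> {-1, 0}" using par by blast
      with * AB show "cross (U $ (2 * i)) (U $ (2 * i + 1))" unfolding cross_def by blast
    qed
    moreover have ?S
    proof (intro allI impI)
      fix i j assume "i < m" "j < m" and *: "\<not> square (U $ (2 * i)) (U $ (2 * i + 1)) \<and>
       \<not> square (U $ (2 * j)) (U $ (2 * j + 1))"
      then have "2 * i < n" "2 * i + 1 < n" "2 * j < n" "2 * j + 1 < n" using n by auto
      with * AB have "2 * i = 2 * j \<or> 2 * i + 1 = 2 * j + 1 \<or> 2 * i = 2 * j + 1 \<or> 2 * i + 1 = 2 * j"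
        unfolding square_def by blast
      then show "i = j" by presburger
    qed
    ultimately show "?X \<and> ?S" ..
  next
    assume XS: "?X \<and> ?S"
    have ?A
      unfolding n all_less_double using XS by (fastforce simp: cross_def)
    moreover have "i = j" if ij: "i < n" "j < n" "U $ i \<notin> {-1, 0}" "U $ j \<notin> {-1, 0}" for i j
    proof -
      have lt: "i div 2 < m" "j div 2 < m" using ij n by auto
      have alt: "l = 2 * (l div 2) \<or> l = 2 * (l div 2) + 1" for l :: nat by presburger
      have "\<not> square (U $ (2 * (l div 2))) (U $ (2 * (l div 2) + 1))" if "U $ l \<notin> {-1, 0}" for l
        using alt[of l] that unfolding square_def by metis
      with XS lt ij have eq: "i div 2 = j div 2" by blast
      show ?thesis
      proof (rule ccontr)
        assume "i \<noteq> j"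
        with eq alt[of i] alt[of j] have
          "U $ (2 * (i div 2)) \<notin> {-1, 0} \<and> U $ (2 * (i div 2) + 1) \<notin> {-1, 0}"
          using ij by metis
        moreover have "cross (U $ (2 * (i div 2))) (U $ (2 * (i div 2) + 1))" using XS lt by blast
        ultimately show False unfolding cross_def by blast
      qed
    qed
    ultimately show "?A \<and> ?B" by blast
  qed
  then show ?thesis unfolding Upsilon_iff by blast
qed

text \<open>The values of \<open>b - 2 * a\<close> at (0, 0), (-1, -1), (-1, 0), (0, -1) are 0, 1,
  2, -1, a complete residue system modulo 4.\<close>

lemma square_ex: "\<exists>a b. square a b \<and> 4 dvd (y - b) - 2 * (x - a)"
proof -
  have "4 dvd y - 2 * x \<or> 4 dvd y - 2 * x - 1 \<or> 4 dvd y - 2 * x - 2 \<or> 4 dvd y - 2 * x - 3"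
    by presburger
  then consider "4 dvd (y - 0) - 2 * (x - 0)" | "4 dvd (y - (-1)) - 2 * (x - (-1))"
    | "4 dvd (y - 0) - 2 * (x - (-1))" | "4 dvd (y - (-1)) - 2 * (x - 0)"
    by atomize_elim presburger
  then show ?thesis unfolding square_def by cases blast+
qed

lemma square_unique:
  assumes "square a b" "square a' b'" "4 dvd (b - b') - 2 * (a - a')"
  shows "a = a' \<and> b = b'"
  using assms by (auto simp: square_def)

text \<open>First coordinates congruent modulo 3 in the range -2 to 1 are equal or are the extremes
  -2 and 1. If equal, \<open>b\<close> and \<open>b'\<close> agree modulo 4 within a range of four
  values. At the extremes both second coordinates lie in \<open>{-1, 0}\<close>, yet would have to
  differ by 2 modulo 4.\<close>

lemma cross_unique:
  assumes "cross a b" "cross a' b'" "4 dvd (b - b') - 2 * (a - a')" "3 dvd a - a'"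
  shows "a = a' \<and> b = b'"
proof -
  have bounds: "-2 \<le> a" "a \<le> 1" "-2 \<le> a'" "a' \<le> 1" "-2 \<le> b" "b \<le> 1" "-2 \<le> b'" "b' \<le> 1"
    using assms(1,2) by (auto simp: cross_def)
  with assms(4) consider "a = a'" | "a = a' + 3" | "a' = a + 3" by atomize_elim presburger
  then show ?thesis
  proof cases
    case 1
    with assms(3) bounds show ?thesis by presburger
  next
    case 2
    with bounds assms(1,2) have "-1 \<le> b \<and> b \<le> 0 \<and> -1 \<le> b' \<and> b' \<le> 0" by (auto simp: cross_def)
    with 2 assms(3) show ?thesis by presburger
  next
    case 3
    with bounds assms(1,2) have "-1 \<le> b \<and> b \<le> 0 \<and> -1 \<le> b' \<and> b' \<le> 0" by (auto simp: cross_def)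
    with 3 assms(3) show ?thesis by presburger
  qed
qed

lemma square_imp_cross: "square a b \<Longrightarrow> cross a b"
  by (auto simp: square_def cross_def)

text \<open>A finite check after two reductions: a square point stands for the class modulo 4, and
  the residue of \<open>z\<close> modulo 3 is the one required of the first coordinate.\<close>

lemma cross_ex: "\<exists>a b. cross a b \<and> 4 dvd (y - b) - 2 * (x - a) \<and> of_int (x - a) = (r :: 3)"
proof -
  obtain a b where ab: "square a b" "4 dvd (y - b) - 2 * (x - a)"
    using square_ex by blast
  define z where "z = x - fst (phi r)"
  have z: "of_int (x - a) = r \<longleftrightarrow> 3 dvd z - a" for a
    unfolding z_def using of_int_3_eq_iff[of "x - a" "fst (phi r)"]
    by (simp add: of_int_fst_phi algebra_simps)
  have "\<exists>a' b'. cross a' b' \<and> 4 dvd (b - b') - 2 * (a - a') \<and> 3 dvd z - a'"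
  proof -
    have "3 dvd z \<or> 3 dvd z - 1 \<or> 3 dvd z + 1" by presburger
    moreover have "(a, b) \<in> {(0, 0), (-1, -1), (-1, 0), (0, -1)}"
      using ab by (auto simp: square_def)
    \<comment> \<open>All twelve points of the cross, in four groups of three: within a group
      \<open>b' - 2 * a'\<close> is constant modulo 4 and the values of \<open>a'\<close> are
      distinct modulo 3.\<close>
    ultimately have "\<exists>(a', b') \<in> {(0, 0), (-2, 0), (-1, -2), (-1, -1), (1, -1), (0, 1),
        (-1, 0), (1, 0), (0, -2), (0, -1), (-2, -1), (-1, 1)}.
      4 dvd (b - b') - 2 * (a - a') \<and> 3 dvd z - a'" (is "\<exists>(a', b') \<in> ?S. ?P a' b'")
      by (elim disjE insertE emptyE; simp; presburger)
    then obtain a' b' where "(a', b') \<in> ?S" and P: "?P a' b'" by blast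
    then have "cross a' b'" by (auto simp: cross_def)
    with P show ?thesis by blast
  qed
  then obtain a' b' where *: "cross a' b'" "4 dvd (b - b') - 2 * (a - a')" "3 dvd z - a'" by blast
  moreover have "4 dvd (y - b') - 2 * (x - a')"
    using dvd_add[OF ab(2) *(2)] by (simp add: algebra_simps)
  ultimately show ?thesis using z by blast
qed

section \<open>Covering and disjointness from perfectness of the code\<close>

lemma integer_tiling_Tset:
  assumes n: "n = 2 * m" and code: "ternary_perfect_code m C"
  shows "integer_tiling n (Upsilon n) (Tset n C)"
proof -
  have C: "C \<subseteq> carrier_vec m"
    and far: "\<And>x y. x \<in> C \<Longrightarrow> y \<in> C \<Longrightarrow> x \<noteq> y \<Longrightarrow> hamming_dist x y \<ge> 3"
    and near: "\<And>w. w \<in> carrier_vec m \<Longrightarrow> \<exists>c\<in>C. hamming_dist w c \<le> 1"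
    using code by (auto simp: ternary_perfect_code_def)
  note T_iff = Tset_iff[OF n C] and U_iff = Upsilon_pairs_iff[OF n]
  have sub: "Tset n C \<subseteq> carrier_vec n" using T_iff by blast
  have cover: "\<exists>X\<in>Tset n C. \<exists>U\<in>Upsilon n. w = X + U" if w: "w \<in> carrier_vec n" for w
  proof -
    have "\<forall>i. \<exists>a b. square a b \<and> 4 dvd (w $ (2 * i + 1) - b) - 2 * (w $ (2 * i) - a)"
      using square_ex by blast
    then obtain a b where sq: "\<And>i. square (a i) (b i)"
      and sq4: "\<And>i. 4 dvd (w $ (2 * i + 1) - b i) - 2 * (w $ (2 * i) - a i)"
      by metis
    \<comment> \<open>The residue word left by the square points alone. It need not be a codeword,
      but one lies within distance 1, and its letters are then prescribed for the cross
      points.\<close>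
    define y :: "3 vec" where "y = vec m (\<lambda>i. of_int (w $ (2 * i) - a i))"
    have yC: "y \<in> carrier_vec m" by (simp add: y_def)
    from near[OF yC] obtain c where c: "c \<in> C" and dist: "hamming_dist y c \<le> 1" by blast
    have "\<forall>i. \<exists>a' b'. cross a' b' \<and> 4 dvd (w $ (2 * i + 1) - b') - 2 * (w $ (2 * i) - a') \<and>
        of_int (w $ (2 * i) - a') = c $ i"
      using cross_ex by blast
    then obtain a' b' where cr: "\<And>i. cross (a' i) (b' i)"
      and cr4: "\<And>i. 4 dvd (w $ (2 * i + 1) - b' i) - 2 * (w $ (2 * i) - a' i)"
      and cr3: "\<And>i. of_int (w $ (2 * i) - a' i) = c $ i"
      by metis
    \<comment> \<open>Where \<open>y\<close> agrees with \<open>c\<close>, the square point already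
      has both required residues and so is the cross point. Hence \<open>U\<close> leaves the square
      only where the two words differ, in at most one pair.\<close>
    have same: "a i = a' i \<and> b i = b' i" if "i < m" "y $ i = c $ i" for i
    proof (rule cross_unique)
      show "4 dvd (b i - b' i) - 2 * (a i - a' i)"
        using dvd_diff[OF cr4[of i] sq4[of i]] by (simp add: algebra_simps)
      have "of_int (w $ (2 * i) - a' i) = (of_int (w $ (2 * i) - a i) :: 3)"
        using that cr3[of i] by (simp add: y_def)
      then show "3 dvd a i - a' i"
        unfolding of_int_3_eq_iff by (simp add: algebra_simps)
    qed (use sq cr square_imp_cross in auto)
    define U where "U = vec n (\<lambda>j. if even j then a' (j div 2) else b' (j div 2))"
    have Ui: "U $ (2 * i) = a' i" "U $ (2 * i + 1) = b' i" if "i < m" for i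
      using that n by (auto simp: U_def)
    have UC: "U \<in> carrier_vec n" by (simp add: U_def)
    have "U \<in> Upsilon n"
      unfolding U_iff
    proof (intro conjI allI impI)
      fix i j assume ij: "i < m" "j < m" and
        "\<not> square (U $ (2 * i)) (U $ (2 * i + 1)) \<and> \<not> square (U $ (2 * j)) (U $ (2 * j + 1))"
      then have "y $ i \<noteq> c $ i" "y $ j \<noteq> c $ j"
        using same[of i] same[of j] sq[of i] sq[of j] Ui by auto
      then have "{i, j} \<subseteq> {i. i < dim_vec y \<and> y $ i \<noteq> c $ i}" using ij yC by auto
      then have "card {i, j} \<le> hamming_dist y c"
        unfolding hamming_dist_def by (rule card_mono[rotated]) auto
      with dist show "i = j" by (cases "i = j") auto
    qed (use UC Ui cr in auto)
    moreover have "w - U \<in> Tset n C"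
      unfolding T_iff
    proof (intro conjI allI impI)
      fix i assume i: "i < m"
      then show "4 dvd (w - U) $ (2 * i + 1) - 2 * (w - U) $ (2 * i)"
        using Ui[OF i] UC w n cr4[of i] by simp
    next
      have "residues3 m (w - U) = c"
        using C c n w UC Ui cr3 by (intro eq_vecI) auto
      then show "residues3 m (w - U) \<in> C" using c by simp
    qed (use w UC in auto)
    moreover have "w = (w - U) + U" using w UC by (intro eq_vecI) auto
    ultimately show ?thesis by blast
  qed
  have unique: "X = X'" if X: "X \<in> Tset n C" "X' \<in> Tset n C" and
    U: "U \<in> Upsilon n" "U' \<in> Upsilon n" and eq: "X + U = X' + U'" for X X' U U'
  proof -
    have XC: "X \<in> carrier_vec n" "X' \<in> carrier_vec n" "U \<in> carrier_vec n" "U' \<in> carrier_vec n"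
      using X U T_iff U_iff by blast+
    have eqi: "X $ j - X' $ j = U' $ j - U $ j" if "j < n" for j
      using arg_cong[OF eq, of "\<lambda>v. v $ j"] that XC by simp
    let ?sq = "\<lambda>U i. square (U $ (2 * i)) (U $ (2 * i + 1))"
    \<comment> \<open>The difference of \<open>U'\<close> and \<open>U\<close> equals that of
      \<open>X\<close> and \<open>X'\<close>, so it inherits the congruences of
      \<open>Tset n C\<close>.\<close>
    have d4: "4 dvd (U' $ (2 * i + 1) - U $ (2 * i + 1)) - 2 * (U' $ (2 * i) - U $ (2 * i))"
      if i: "i < m" for i
    proof -
      have "4 dvd X $ (2 * i + 1) - 2 * X $ (2 * i)" "4 dvd X' $ (2 * i + 1) - 2 * X' $ (2 * i)"
        using X i unfolding T_iff by blast+
      from dvd_diff[OF this]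
      have "4 dvd (X $ (2 * i + 1) - X' $ (2 * i + 1)) - 2 * (X $ (2 * i) - X' $ (2 * i))"
        by (simp add: algebra_simps)
      then show ?thesis using eqi[of "2 * i"] eqi[of "2 * i + 1"] i n by simp
    qed
    let ?c = "residues3 m X" and ?c' = "residues3 m X'"
    have c: "?c \<in> C" "?c' \<in> C" using X T_iff by blast+
    have c_eq: "?c $ i = ?c' $ i \<longleftrightarrow> 3 dvd U' $ (2 * i) - U $ (2 * i)" if "i < m" for i
      using that n by (simp add: of_int_3_eq_iff eqi)
    have "?c = ?c'"
    proof (rule ccontr)
      assume ne: "?c \<noteq> ?c'"
      \<comment> \<open>Each point of \<open>Upsilon n\<close> leaves the square in at most one
        pair. Elsewhere both points are in the square and \<open>square_unique\<close> makes the
        letters equal, so distinct codewords would have distance at most 2.\<close>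
      define D where "D U = {i. i < m \<and> \<not> ?sq U i}" for U
      have "finite (D V) \<and> card (D V) \<le> 1" if "V \<in> Upsilon n" for V
      proof -
        have "finite (D V)" by (simp add: D_def)
        moreover have "\<forall>i\<in>D V. \<forall>j\<in>D V. i = j"
          using that unfolding U_iff D_def by blast
        ultimately show ?thesis by (auto simp: card_le_Suc0_iff_eq)
      qed
      from this[OF U(1)] this[OF U(2)]
      have "finite (D U \<union> D U')" "card (D U \<union> D U') \<le> 2"
        using card_Un_le[of "D U" "D U'"] by auto
      moreover have "{i. i < dim_vec ?c \<and> ?c $ i \<noteq> ?c' $ i} \<subseteq> D U \<union> D U'"
      proof
        fix i assume "i \<in> {i. i < dim_vec ?c \<and> ?c $ i \<noteq> ?c' $ i}"
        then have i: "i < m" "?c $ i \<noteq> ?c' $ i" by auto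
        show "i \<in> D U \<union> D U'"
        proof (rule ccontr)
          assume "i \<notin> D U \<union> D U'"
          then have "?sq U i" "?sq U' i" using i by (auto simp: D_def)
          from square_unique[OF this(2,1) d4[OF i(1)]] have "U' $ (2 * i) = U $ (2 * i)" by simp
          then show False using i c_eq by simp
        qed
      qed
      ultimately have "hamming_dist ?c ?c' \<le> 2"
        unfolding hamming_dist_def using card_mono order_trans by blast
      with far[OF c ne] show False by simp
    qed
    \<comment> \<open>Equality of the residue words supplies the congruence modulo 3 that
      \<open>cross_unique\<close> needs in every pair.\<close>
    have "U' $ (2 * i) = U $ (2 * i) \<and> U' $ (2 * i + 1) = U $ (2 * i + 1)" if i: "i < m" for i
    proof (rule cross_unique[OF _ _ d4[OF i]])
      show "3 dvd U' $ (2 * i) - U $ (2 * i)"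
        using c_eq[OF i] \<open>?c = ?c'\<close> by simp
    qed (use U i U_iff in blast)+
    then have "\<forall>j<n. U' $ j = U $ j"
      unfolding n all_less_double by blast
    then show ?thesis
      using XC eqi by (intro eq_vecI) force+
  qed
  have "(\<Union>X\<in>Tset n C. (\<lambda>U. X + U) ` Upsilon n) = carrier_vec n"
  proof (intro equalityI subsetI)
    fix w assume "w \<in> (\<Union>X\<in>Tset n C. (\<lambda>U. X + U) ` Upsilon n)"
    then show "w \<in> carrier_vec n" using sub U_iff by auto
  next
    fix w :: "int vec" assume "w \<in> carrier_vec n"
    from cover[OF this] show "w \<in> (\<Union>X\<in>Tset n C. (\<lambda>U. X + U) ` Upsilon n)" by blast
  qed
  moreover have "disjoint_family_on (\<lambda>X. (\<lambda>U. X + U) ` Upsilon n) (Tset n C)"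
    unfolding disjoint_family_on_def using unique by blast
  ultimately show ?thesis
    unfolding integer_tiling_def using sub by blast
qed

section \<open>Linear codes give lattices\<close>

lemma is_lattice_Tset:
  assumes n: "n = 2 * m" and C: "linear_code m C"
  shows "is_lattice n (map_vec real_of_int ` Tset n C)"
proof -
  interpret C: submodule class_ring C "module_vec TYPE(3) m"
    using C by (simp add: subspace_def)
  have CC: "C \<subseteq> carrier_vec m" using C.subset by (simp add: module_vec_simps)
  have C0: "0\<^sub>v m \<in> C" using C.zero_closed by (simp add: module_vec_simps)
  have Cdiff: "c - d \<in> C" if "c \<in> C" "d \<in> C" for c d
  proof -
    have "(-1) \<cdot>\<^sub>v d \<in> C" using C.smult_closed[of "-1" d] that
      by (simp add: module_vec_simps class_ring_simps)
    then have "c + (-1) \<cdot>\<^sub>v d \<in> C" using C.m_closed that by (simp add: module_vec_simps)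
    moreover have "c + (-1) \<cdot>\<^sub>v d = c - d" using CC that by (intro eq_vecI) auto
    ultimately show ?thesis by simp
  qed
  note T_iff = Tset_iff[OF n CC]
  \<comment> \<open>Divisibility by 12 = 4 * 3 settles the congruences modulo 4 and makes the
    residue word zero. This yields both the zero vector and the multiples of unit vectors that bound
    the index.\<close>
  have *: "x \<in> Tset n C" if "x \<in> carrier_vec n" "\<And>j. j < n \<Longrightarrow> 12 dvd x $ j" for x
    unfolding T_iff
  proof (intro conjI allI impI)
    fix i assume "i < m"
    then have "12 dvd x $ (2 * i + 1)" "12 dvd x $ (2 * i)" using that n by auto
    then show "4 dvd x $ (2 * i + 1) - 2 * x $ (2 * i)" by presburger
  next
    have "3 dvd x $ (2 * i)" if "i < m" for i
    proof -
      have "12 dvd x $ (2 * i)" using \<open>i < m\<close> \<open>\<And>j. j < n \<Longrightarrow> 12 dvd x $ j\<close> n by auto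
      then show ?thesis by presburger
    qed
    then have "residues3 m x = 0\<^sub>v m" by (intro eq_vecI) (auto simp: of_int_3_eq_0_iff)
    then show "residues3 m x \<in> C" using C0 by simp
  qed (rule that)
  interpret T: int_vec_subgroup n "Tset n C"
  proof
    show "Tset n C \<subseteq> carrier_vec n" using T_iff by blast
    show "0\<^sub>v n \<in> Tset n C" by (rule *) auto
    fix x y assume xy: "x \<in> Tset n C" "y \<in> Tset n C"
    then have xyC: "x \<in> carrier_vec n" "y \<in> carrier_vec n" using T_iff by auto
    show "x - y \<in> Tset n C"
      unfolding T_iff
    proof (intro conjI allI impI)
      fix i assume i: "i < m"
      then have "4 dvd x $ (2 * i + 1) - 2 * x $ (2 * i)" "4 dvd y $ (2 * i + 1) - 2 * y $ (2 * i)"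
        using xy unfolding T_iff by blast+
      from dvd_diff[OF this] show "4 dvd (x - y) $ (2 * i + 1) - 2 * (x - y) $ (2 * i)"
        using i n xyC by (simp add: algebra_simps)
    next
      \<comment> \<open>Taking residues commutes with subtraction, and a linear code is closed under
        differences.\<close>
      have "residues3 m (x - y) = residues3 m x - residues3 m y"
        using n xyC by (intro eq_vecI) auto
      then show "residues3 m (x - y) \<in> C" using Cdiff xy T_iff by simp
    qed (use xyC in auto)
  qed
  show ?thesis
    by (rule T.is_lattice[of 12]) (auto intro!: * simp: unit_vec_def)
qed

theorem theorem9:
  fixes t n \<nu> :: nat and C :: "3 vec set"
  assumes "t > 0"
    and "n = 3 ^ t - 1"
    and "\<nu> = n div 2"
    and "ternary_perfect_code \<nu> C"
    and "linear_code \<nu> C"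
  shows "lattice_tiling n (Upsilon n) (Tset n C)"
proof -
  \<comment> \<open>Powers of 3 are odd, so the coordinates split into pairs without
    remainder.\<close>
  have "even n" using assms(2) by simp
  then have "n = 2 * \<nu>" using assms(3) by simp
  then show ?thesis
    unfolding lattice_tiling_def
    using is_lattice_Tset integer_tiling_Tset assms(4,5) by blast
qed

end
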